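(* Let $X$ be a set and let $\mathcal{A}$ be a set of subsets of $X$. Then there exists an ordinal $\alpha_0\le \omega_0+1$ such that $[\mathcal{A}]_0=\Phi^{\alpha}(\mathcal{A})$ for all ordinals $\alpha\ge\alpha_0$. The integral connectivity structure $[\mathcal{A}]$ generated by $\mathcal{A}$ is obtained in the same way, adding the singletons of $X$ at any stage of the process.
   Context: A connectivity structure on a set $X$ is a set $\mathcal{K}$ of subsets of $X$ with $\emptyset\in\mathcal{K}$ such that for every $\mathcal{I}\subseteq\mathcal{K}$, if $\bigcap_{K\in\mathcal{I}}K\neq\emptyset$ then $\bigcup_{K\in\mathcal{I}}K\in\mathcal{K}$. It is integral if it contains every singleton $\{x\}$, $x\in X$. For a set $\mathcal{A}$ of subsets of $X$, $[\mathcal{A}]_0$ (resp. $[\mathcal{A}]$) denotes the smallest (for inclusion) connectivity structure (resp. integral connectivity structure) on $X$ containing $\mathcal{A}$; it is called the connectivity structure (resp. integral connectivity structure) generated by $\mathcal{A}$. $\omega_0$ is the smallest infinite ordinal. For a set $\mathcal{U}$ of subsets of $X$ put $$\Phi(\mathcal{U})=\{\emptyset\}\cup\Big\{\bigcup_{A\in\mathcal{E}}A : \mathcal{E}\subseteq\mathcal{U},\ \bigcap_{A\in\mathcal{E}}A\neq\emptyset\Big\}.$$ Define operators $\Phi^\alpha$ on sets of subsets of $X$, for every ordinal $\alpha$, by transfinite induction: $\Phi^0(\mathcal{U})=\mathcal{U}$; if $\alpha=\beta+1$ for an ordinal $\beta$, then $\Phi^{\alpha}(\mathcal{U})=\Phi(\Phi^\beta(\mathcal{U}))$;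 otherwise (that is, for a limit ordinal $\alpha>0$) $\Phi^\alpha(\mathcal{U})=\bigcup_{\beta<\alpha}\Phi^\beta(\mathcal{U})$. The "process" mentioned in the claim is this transfinite iteration of $\Phi$ starting from $\mathcal{A}$. *)

theory Defs
  imports Main
begin

unbundle cardinal_syntax

section \<open>Ordinals\<close>

text \<open>
  Ordinals are order types of well-orders. HOL has no type of all ordinals;
  \<open>'b ordinal\<close> consists of the order types of the well-orders on subsets of \<open>nat + 'b\<close>,
  i.e. of all ordinals of cardinality at most that of \<open>nat + 'b\<close>. The summand \<open>nat\<close>
  makes it contain the countable ordinals for every \<open>'b\<close>; since \<open>'b\<close> is
  arbitrary, a statement with a free type variable \<open>'b\<close> covers every ordinal.
\<close>

quotient_type 'b ordinal = "(nat + 'b) rel" / partial: "\<lambda>r s. r =o s"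
proof (rule part_equivpI)
  show "\<exists>r :: (nat + 'b) rel. r =o r"
    by (rule exI[of _ "{}"]) (rule ordIso_reflexive, simp)
  show "symp (\<lambda>r s :: (nat + 'b) rel. r =o s)"
    by (rule sympI) (rule ordIso_symmetric)
  show "transp (\<lambda>r s :: (nat + 'b) rel. r =o s)"
    by (rule transpI) (rule ordIso_transitive)
qed

instantiation ordinal :: (type) "{zero, linorder}"
begin

lift_definition zero_ordinal :: "'a ordinal" is "{}"
  by (rule ordIso_reflexive) simp

lift_definition less_eq_ordinal :: "'a ordinal \<Rightarrow> 'a ordinal \<Rightarrow> bool" is "\<lambda>r s. r \<le>o s"
  by (meson ordIso_symmetric ordIso_ordLeq_trans ordLeq_ordIso_trans)

lift_definition less_ordinal :: "'a ordinal \<Rightarrow> 'a ordinal \<Rightarrow> bool" is "\<lambda>r s. r <o s"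
  by (meson ordIso_symmetric ordIso_ordLess_trans ordLess_ordIso_trans)

instance
proof
  fix x y z :: "'a ordinal"
  show "x < y \<longleftrightarrow> x \<le> y \<and> \<not> y \<le> x"
    by transfer (meson ordIso_imp_ordLeq ordLeq_Well_order_simp not_ordLess_iff_ordLeq
        not_ordLess_ordLeq ordLess_imp_ordLeq)
  show "x \<le> x"
    by transfer (rule ordIso_imp_ordLeq)
  show "x \<le> y \<Longrightarrow> y \<le> z \<Longrightarrow> x \<le> z"
    by transfer (rule ordLeq_transitive)
  show "x \<le> y \<Longrightarrow> y \<le> x \<Longrightarrow> x = y"
    by transfer (simp add: ordIso_iff_ordLeq)
  show "x \<le> y \<or> y \<le> x"
    by transfer (meson ordIso_imp_ordLeq ordLeq_Well_order_simp ordLeq_total)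
qed

end

instance ordinal :: (type) wellorder
proof (rule wf_wellorderI)
  have "wf (inv_image ordLess rep_ordinal :: 'a ordinal rel)"
    by (rule wf_inv_image) (rule wf_ordLess)
  moreover have "{(x, y :: 'a ordinal). x < y} \<subseteq> inv_image ordLess rep_ordinal"
    by (auto simp: less_ordinal_def inv_image_def)
  ultimately show "wf {(x, y :: 'a ordinal). x < y}"
    by (rule wf_subset)
qed standard

lemma zero_le_ordinal: "(0 :: 'b ordinal) \<le> \<alpha>"
proof transfer
  fix r :: "(nat + 'b) rel"
  assume "r =o r"
  then have r: "Well_order r"
    by (simp add: ordIso_def)
  show "{} \<le>o r"
    using r by (auto simp: ordLeq_def embed_def)
qed

lemma ex_greater_ordinal: "\<exists>\<beta> :: 'b ordinal. \<alpha> < \<beta>"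
proof transfer
  fix r :: "(nat + 'b) rel"
  assume "r =o r"
  then have r: "Well_order r"
    by (simp add: ordIso_def)
  define f :: "nat + 'b \<Rightarrow> nat + 'b" where "f = map_sum Suc id"
  define e :: "nat + 'b" where "e = Inl 0"
  define r' where "r' = dir_image r f"
  define s where "s = r' \<union> (Field r' \<union> {e}) \<times> {e}"
  have f: "inj f"
    unfolding f_def by (intro sum.inj_map) auto
  have fe: "f x \<noteq> e" for x
    by (cases x) (auto simp: f_def e_def)
  have inj: "inj_on f (Field r)"
    using f by (rule inj_on_subset) simp
  have r': "Well_order r'"
    unfolding r'_def using r inj by (rule Well_order_dir_image)
  have iso: "r =o r'"
    unfolding r'_def using r inj by (rule dir_image_ordIso)
  have e: "e \<notin> Field r'"
    using fe by (auto simp: r'_def dir_image_Field)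
  have Fs: "Field s = insert e (Field r')"
    by (auto simp: s_def Field_def)
  have tr: "trans r'" and an: "antisym r'" and rf: "Refl r'" and tot: "Total r'"
    using r' by (auto simp: order_on_defs)
  have mem: "x \<in> Field r' \<and> y \<in> Field r'" if "(x, y) \<in> r'" for x y
    using that by (auto simp: Field_def)
  have lin: "Linear_order s"
    unfolding order_on_defs
  proof (intro conjI)
    show "s \<subseteq> Field s \<times> Field s"
      by (auto simp: Field_def)
    show "Refl s"
      using rf unfolding refl_on_def Fs by (auto simp: s_def)
    show "trans s"
      using tr e mem unfolding s_def trans_def by blast
    show "antisym s"
      using an e mem unfolding s_def antisym_def by blast
    show "Total s"
      using tot unfolding total_on_def Fs by (auto simp: s_def)
  qed
  have wo: "Well_order s"
    unfolding Linear_order_Well_order_iff[OF lin]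
  proof (intro allI impI)
    fix A assume A: "A \<subseteq> Field s" "A \<noteq> {}"
    show "\<exists>a\<in>A. \<forall>a'\<in>A. (a, a') \<in> s"
    proof (cases "A \<inter> Field r' = {}")
      case True
      then have "A = {e}"
        using A Fs by auto
      then show ?thesis
        by (auto simp: s_def)
    next
      case False
      have "\<forall>B\<subseteq>Field r'. B \<noteq> {} \<longrightarrow> (\<exists>a\<in>B. \<forall>a'\<in>B. (a, a') \<in> r')"
        using Linear_order_Well_order_iff[of r'] r' by (simp add: well_order_on_def)
      then obtain a where "a \<in> A \<inter> Field r'" "\<forall>a'\<in>A \<inter> Field r'. (a, a') \<in> r'"
        using False by (metis inf.cobounded2)
      then show ?thesis
        using A Fs by (auto simp: s_def intro!: bexI[of _ a])
    qed
  qed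
  have "Restr s (underS s e) = r'"
    using e mem by (auto simp: s_def underS_def)
  moreover have "Restr s (underS s e) <o s"
    using wo Fs by (intro underS_Restr_ordLess) auto
  ultimately have "r <o s"
    using iso by (simp add: ordIso_ordLess_trans)
  moreover have "s =o s"
    using wo by (rule ordIso_reflexive)
  ultimately show "\<exists>s\<in>{s :: (nat + 'b) rel. s =o s}. r <o s"
    by blast
qed

definition ord_succ :: "'b ordinal \<Rightarrow> 'b ordinal" where
  "ord_succ \<alpha> = (LEAST \<beta>. \<alpha> < \<beta>)"

lemma less_ord_succ: "\<alpha> < ord_succ \<alpha>"
  unfolding ord_succ_def by (rule LeastI_ex) (rule ex_greater_ordinal)

lemma ord_succ_le_iff: "ord_succ \<alpha> \<le> \<beta> \<longleftrightarrow> \<alpha> < \<beta>"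
  using less_ord_succ[of \<alpha>] by (auto simp: ord_succ_def intro: Least_le)

lemma ord_succ_inject: "ord_succ \<alpha> = ord_succ \<beta> \<longleftrightarrow> \<alpha> = \<beta>"
  by (metis less_ord_succ ord_succ_le_iff leD linorder_cases)

lemma the_ord_pred: "(THE \<beta>. ord_succ \<alpha> = ord_succ \<beta>) = \<alpha>"
  by (simp add: ord_succ_inject)

text \<open>\<open>{..<\<alpha>}\<close> is a well-order of type \<open>\<alpha>\<close>, so an ordinal is infinite iff it has
  infinitely many predecessors.\<close>

definition omega0 :: "'b ordinal" where
  "omega0 = (LEAST \<alpha>. infinite {..<\<alpha>})"

lemma infinite_omega0: "infinite {..<omega0 :: 'b ordinal}"
proof -
  define R where "R = (\<lambda>r. dir_image r (Inl :: nat \<Rightarrow> nat + 'b))"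
  define on where "on = (\<lambda>n. abs_ordinal (R (natLeq_on n)) :: 'b ordinal)"
  have F: "Field (R r) = Inl ` Field r" for r
    by (simp add: R_def dir_image_Field)
  have W: "Well_order r \<Longrightarrow> Well_order (R r)" for r
    unfolding R_def by (rule Well_order_dir_image) auto
  have refl: "Well_order r \<Longrightarrow> R r =o R r" for r
    by (rule ordIso_reflexive) (rule W)
  have lt: "on n < abs_ordinal (R natLeq)" for n
  proof -
    have "R (natLeq_on n) <o R natLeq"
      using W[OF natLeq_on_Well_order] W[OF natLeq_Well_order]
      by (rule finite_ordLess_infinite)
        (auto simp: F Field_natLeq_on Field_natLeq finite_image_iff)
    then show ?thesis
      unfolding on_def
      by (simp add: less_ordinal.abs_eq refl natLeq_on_Well_order natLeq_Well_order)
  qed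
  have "inj on"
  proof (rule injI)
    fix m n assume "on m = on n"
    then have "R (natLeq_on m) =o R (natLeq_on n)"
      unfolding on_def
      using Quotient3_rel[OF Quotient3_ordinal] refl natLeq_on_Well_order by blast
    then obtain f where "iso (R (natLeq_on m)) (R (natLeq_on n)) f"
      by (auto simp: ordIso_def)
    then have "bij_betw f (Inl ` {x. x < m} :: (nat + 'b) set) (Inl ` {x. x < n})"
      by (simp add: iso_def F Field_natLeq_on)
    then have "card (Inl ` {x. x < m} :: (nat + 'b) set) = card (Inl ` {x. x < n} :: (nat + 'b) set)"
      by (rule bij_betw_same_card)
    then show "m = n"
      by (simp add: card_image)
  qed
  then have "infinite (range on)"
    by (simp add: finite_image_iff)
  then have "infinite {..<abs_ordinal (R natLeq)}"
    using lt by (metis (no_types, lifting) finite_subset image_subsetI lessThan_iff)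
  then show ?thesis
    unfolding omega0_def by (rule LeastI)
qed


section \<open>Connectivity structures\<close>

definition connectivity_structure :: "'a set \<Rightarrow> 'a set set \<Rightarrow> bool" where
  "connectivity_structure X K \<longleftrightarrow>
     K \<subseteq> Pow X \<and> {} \<in> K \<and> (\<forall>I\<subseteq>K. \<Inter>I \<noteq> {} \<longrightarrow> \<Union>I \<in> K)"

definition singletons :: "'a set \<Rightarrow> 'a set set" where
  "singletons X = (\<lambda>x. {x}) ` X"

definition integral_connectivity_structure :: "'a set \<Rightarrow> 'a set set \<Rightarrow> bool" where
  "integral_connectivity_structure X K \<longleftrightarrow>
     connectivity_structure X K \<and> singletons X \<subseteq> K"

definition generated0 :: "'a set \<Rightarrow> 'a set set \<Rightarrow> 'a set set" where
  "generated0 X A = (LEAST K. connectivity_structure X K \<and> A \<subseteq> K)"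

definition generated :: "'a set \<Rightarrow> 'a set set \<Rightarrow> 'a set set" where
  "generated X A = (LEAST K. integral_connectivity_structure X K \<and> A \<subseteq> K)"

lemma connectivity_structure_Pow: "connectivity_structure X (Pow X)"
  by (auto simp: connectivity_structure_def)

lemma connectivity_structure_Inter:
  assumes "\<K> \<noteq> {}" and "\<And>K. K \<in> \<K> \<Longrightarrow> connectivity_structure X K"
  shows "connectivity_structure X (\<Inter>\<K>)"
  unfolding connectivity_structure_def
proof (intro conjI allI impI)
  show "\<Inter>\<K> \<subseteq> Pow X" "{} \<in> \<Inter>\<K>"
    using assms by (auto simp: connectivity_structure_def)
  show "\<Union>I \<in> \<Inter>\<K>" if "I \<subseteq> \<Inter>\<K>" "\<Inter>I \<noteq> {}" for I
    using that assms(2) unfolding connectivity_structure_def by (metis InterI le_Inf_iff)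
qed

lemma generated0_eq_Inter:
  assumes "A \<subseteq> Pow X"
  shows "generated0 X A = \<Inter>{K. connectivity_structure X K \<and> A \<subseteq> K}"
  unfolding generated0_def
proof (rule Least_equality)
  let ?\<K> = "{K. connectivity_structure X K \<and> A \<subseteq> K}"
  have "Pow X \<in> ?\<K>"
    using assms by (simp add: connectivity_structure_Pow)
  then show "connectivity_structure X (\<Inter>?\<K>) \<and> A \<subseteq> \<Inter>?\<K>"
    by (intro conjI connectivity_structure_Inter) auto
qed auto

lemma generated_eq_Inter:
  assumes "A \<subseteq> Pow X"
  shows "generated X A = \<Inter>{K. integral_connectivity_structure X K \<and> A \<subseteq> K}"
  unfolding generated_def
proof (rule Least_equality)
  let ?\<K> = "{K. integral_connectivity_structure X K \<and> A \<subseteq> K}"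
  have "Pow X \<in> ?\<K>"
    using assms
    by (auto simp: connectivity_structure_Pow integral_connectivity_structure_def singletons_def)
  then have "connectivity_structure X (\<Inter>?\<K>)"
    by (intro connectivity_structure_Inter) (auto simp: integral_connectivity_structure_def)
  then show "integral_connectivity_structure X (\<Inter>?\<K>) \<and> A \<subseteq> \<Inter>?\<K>"
    by (auto simp: integral_connectivity_structure_def)
qed auto


section \<open>Transfinite iteration\<close>

definition Phi :: "'a set set \<Rightarrow> 'a set set" where
  "Phi U = {{}} \<union> {\<Union>E | E. E \<subseteq> U \<and> \<Inter>E \<noteq> {}}"

function Phi_pow :: "'b ordinal \<Rightarrow> 'a set set \<Rightarrow> 'a set set" where
  "Phi_pow \<alpha> U =
     (if \<alpha> = 0 then U
      else if \<exists>\<beta>. \<alpha> = ord_succ \<beta> then Phi (Phi_pow (THE \<beta>. \<alpha> = ord_succ \<beta>) U)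
      else (\<Union>\<beta>\<in>{..<\<alpha>}. Phi_pow \<beta> U))"
  by auto
termination
  by (relation "inv_image {(\<beta>, \<alpha>). \<beta> < \<alpha>} fst")
    (auto simp: wf the_ord_pred less_ord_succ)

declare Phi_pow.simps [simp del]

text \<open>The same process, except that the sets in \<open>S\<close> are added at stage \<open>\<gamma>\<close>: stage \<open>\<gamma>\<close>
  is computed from the earlier ones as before, then enlarged by \<open>S\<close>, and the process goes on
  from the result.\<close>

function Phi_pow_adding ::
    "'a set set \<Rightarrow> 'b ordinal \<Rightarrow> 'b ordinal \<Rightarrow> 'a set set \<Rightarrow> 'a set set" where
  "Phi_pow_adding S \<gamma> \<alpha> U =
     (if \<alpha> = 0 then U
      else if \<exists>\<beta>. \<alpha> = ord_succ \<beta>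
        then Phi (Phi_pow_adding S \<gamma> (THE \<beta>. \<alpha> = ord_succ \<beta>) U)
      else (\<Union>\<beta>\<in>{..<\<alpha>}. Phi_pow_adding S \<gamma> \<beta> U))
     \<union> (if \<alpha> = \<gamma> then S else {})"
  by auto
termination
  by (relation "inv_image {(\<beta>, \<alpha>). \<beta> < \<alpha>} (\<lambda>(S, \<gamma>, \<alpha>, U). \<alpha>)")
    (auto simp: wf the_ord_pred less_ord_succ)

declare Phi_pow_adding.simps [simp del]

lemma ord_succ_nonzero: "ord_succ \<alpha> \<noteq> 0"
  by (metis less_ord_succ leD zero_le_ordinal)

lemma Phi_pow_0: "Phi_pow 0 U = U"
  by (simp add: Phi_pow.simps)

lemma Phi_pow_succ: "Phi_pow (ord_succ \<beta>) U = Phi (Phi_pow \<beta> U)"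
  by (subst Phi_pow.simps) (auto simp: the_ord_pred ord_succ_nonzero)

lemma Phi_pow_limit:
  "\<alpha> \<noteq> 0 \<Longrightarrow> (\<And>\<beta>. \<alpha> \<noteq> ord_succ \<beta>) \<Longrightarrow> Phi_pow \<alpha> U = (\<Union>\<beta>\<in>{..<\<alpha>}. Phi_pow \<beta> U)"
  by (subst Phi_pow.simps) auto

lemma Phi_pow_adding_less: "\<alpha> < \<gamma> \<Longrightarrow> Phi_pow_adding S \<gamma> \<alpha> U = Phi_pow \<alpha> U"
proof (induction \<alpha> rule: less_induct)
  case (less \<alpha>)
  show ?case
  proof (cases "\<exists>\<beta>. \<alpha> = ord_succ \<beta>")
    case True
    then obtain \<beta> where \<beta>: "\<alpha> = ord_succ \<beta>" by blast
    then have "Phi_pow_adding S \<gamma> \<beta> U = Phi_pow \<beta> U"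
      using less less_ord_succ[of \<beta>] by auto
    then show ?thesis
      using less.prems unfolding \<beta>
      by (subst Phi_pow_adding.simps) (auto simp: Phi_pow_succ the_ord_pred ord_succ_nonzero)
  next
    case False
    have "Phi_pow_adding S \<gamma> \<beta> U = Phi_pow \<beta> U" if "\<beta> < \<alpha>" for \<beta>
      using less that by auto
    then show ?thesis
      using False less.prems
      by (subst Phi_pow_adding.simps, subst Phi_pow.simps) auto
  qed
qed

lemma Phi_pow_adding_same: "Phi_pow_adding S \<gamma> \<gamma> U = Phi_pow \<gamma> U \<union> S"
proof (cases "\<exists>\<beta>. \<gamma> = ord_succ \<beta>")
  case True
  then obtain \<beta> where \<beta>: "\<gamma> = ord_succ \<beta>" by blast
  show ?thesis
    unfolding \<beta> by (subst Phi_pow_adding.simps)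
      (simp add: Phi_pow_succ the_ord_pred ord_succ_nonzero Phi_pow_adding_less less_ord_succ,
       metis)
next
  case False
  then show ?thesis
    by (subst Phi_pow_adding.simps, subst Phi_pow.simps) (auto simp: Phi_pow_adding_less)
qed

lemma Phi_pow_adding_succ:
  "\<gamma> \<le> \<beta> \<Longrightarrow> Phi_pow_adding S \<gamma> (ord_succ \<beta>) U = Phi (Phi_pow_adding S \<gamma> \<beta> U)"
  using less_ord_succ[of \<beta>]
  by (subst Phi_pow_adding.simps) (auto simp: the_ord_pred ord_succ_nonzero)

end

theory Submission
  imports Defs
begin

text \<open>
  Stage \<open>\<omega>\<^sub>0\<close> of the process is closed under unions of two intersecting sets, as two of its
  members already occur together at some earlier stage. One further application of \<open>\<Phi>\<close> then
  suffices: if \<open>x \<in> \<Union>E\<close> where the members of \<open>E\<close> share a point, fix \<open>B \<in> E\<close> with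
  \<open>x \<in> B\<close>; the sets \<open>C \<union> B\<close> with \<open>C \<in> E\<close> have union \<open>\<Union>E\<close> and all contain \<open>x\<close>. Hence a
  union of such sets \<open>\<Union>E\<close> through a common \<open>x\<close> is again the union of a single family through
  \<open>x\<close>. Singletons may be added at any stage because a singleton meeting a set is absorbed by it.
\<close>

section \<open>One application of \<open>Phi\<close>, and connectivity structures\<close>

lemma Phi_superset: "U \<subseteq> Phi U"
proof
  fix C assume "C \<in> U"
  show "C \<in> Phi U"
  proof (cases "C = {}")
    case False
    then have "\<Union>{C} \<in> Phi U"
      using \<open>C \<in> U\<close> unfolding Phi_def by (intro UnI2 CollectI exI[of _ "{C}"]) auto
    then show ?thesis by simp
  qed (simp add: Phi_def)
qed

lemma Phi_binary_union:
  assumes "C \<in> U" "D \<in> U" "C \<inter> D \<noteq> {}"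
  shows "C \<union> D \<in> Phi U"
proof -
  have "\<Union>{C, D} \<in> Phi U"
    using assms unfolding Phi_def by (intro UnI2 CollectI exI[of _ "{C, D}"]) auto
  then show ?thesis by simp
qed

lemma Phi_subset_connectivity_structure:
  assumes "connectivity_structure X K" "U \<subseteq> K"
  shows "Phi U \<subseteq> K"
proof
  fix C assume "C \<in> Phi U"
  then consider "C = {}" | E where "C = \<Union>E" "E \<subseteq> U" "\<Inter>E \<noteq> {}"
    by (auto simp: Phi_def)
  then show "C \<in> K"
    using assms by cases (simp_all add: connectivity_structure_def)
qed

lemma connectivity_structure_Phi:
  assumes sub: "F \<subseteq> Pow X"
    and bin: "\<And>C D. C \<in> F \<Longrightarrow> D \<in> F \<Longrightarrow> C \<inter> D \<noteq> {} \<Longrightarrow> C \<union> D \<in> F"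
  shows "connectivity_structure X (Phi F)"
  unfolding connectivity_structure_def
proof (intro conjI allI impI)
  show "Phi F \<subseteq> Pow X"
    using sub by (rule Phi_subset_connectivity_structure[OF connectivity_structure_Pow])
  show "{} \<in> Phi F"
    by (simp add: Phi_def)
next
  fix I assume I: "I \<subseteq> Phi F" "\<Inter>I \<noteq> {}"
  then obtain x where x: "\<And>K. K \<in> I \<Longrightarrow> x \<in> K"
    by blast
  \<comment> \<open>Taking every member of \<open>F\<close> through \<open>x\<close> inside
    \<open>\<Union>I\<close> avoids choosing a family for each \<open>K\<close>. If \<open>I\<close>
    is empty then \<open>\<Union>E\<close> is empty too, and \<open>\<Inter>E\<close> still contains
    \<open>x\<close>.\<close>
  define E where "E = {C \<in> F. x \<in> C \<and> C \<subseteq> \<Union>I}"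
  have "y \<in> \<Union>E" if "K \<in> I" "y \<in> K" for K y
  proof -
    have "K \<in> Phi F" "K \<noteq> {}"
      using that I by auto
    then obtain E' where E': "E' \<subseteq> F" "\<Inter>E' \<noteq> {}" "K = \<Union>E'"
      by (auto simp: Phi_def)
    obtain B C where BC: "B \<in> E'" "x \<in> B" "C \<in> E'" "y \<in> C"
      using x[OF \<open>K \<in> I\<close>] \<open>y \<in> K\<close> unfolding E'(3) by blast
    then have "C \<inter> B \<noteq> {}"
      using E'(2) by blast
    then have "C \<union> B \<in> F"
      using bin BC E'(1) by blast
    moreover have "C \<union> B \<subseteq> \<Union>I"
      using BC E'(3) \<open>K \<in> I\<close> by blast
    ultimately show ?thesis
      using BC by (auto simp: E_def)
  qed
  then have "\<Union>I = \<Union>E"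
    by (auto simp: E_def)
  moreover have "\<Union>E \<in> Phi F"
    unfolding Phi_def by (intro UnI2 CollectI exI[of _ E]) (auto simp: E_def)
  ultimately show "\<Union>I \<in> Phi F"
    by simp
qed

text \<open>In a family with a common point \<open>x\<close>, a member taken from \<open>S\<close>
  can only be \<open>{x}\<close>, which every other member absorbs. This handles singletons that
  arrive after the last needed use of \<open>Phi\<close>.\<close>

lemma connectivity_structure_Un_singletons:
  assumes K: "connectivity_structure X K" and S: "S \<subseteq> singletons X"
  shows "connectivity_structure X (K \<union> S)"
  unfolding connectivity_structure_def
proof (intro conjI allI impI)
  show "K \<union> S \<subseteq> Pow X" "{} \<in> K \<union> S"
    using K S by (auto simp: connectivity_structure_def singletons_def)
next
  fix I assume I: "I \<subseteq> K \<union> S" "\<Inter>I \<noteq> {}"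
  then obtain x where x: "\<And>C. C \<in> I \<Longrightarrow> x \<in> C"
    by blast
  have single: "C = {x}" if "C \<in> I" "C \<notin> K" for C
  proof -
    have "C \<in> singletons X"
      using that I S by blast
    then show ?thesis
      using x[OF \<open>C \<in> I\<close>] by (auto simp: singletons_def)
  qed
  show "\<Union>I \<in> K \<union> S"
  proof (cases "I \<inter> K = {}")
    case True
    then have "I \<subseteq> {{x}}"
      using single by blast
    \<comment> \<open>The empty family satisfies the hypothesis because \<open>\<Inter>{}\<close> is
      \<open>UNIV\<close>; its union \<open>{}\<close> lies in \<open>K\<close>.\<close>
    then have "I = {} \<or> I = {{x}}"
      by blast
    then show ?thesis
      using I K by (auto simp: connectivity_structure_def)
  next
    case False
    then have "\<Union>I = \<Union>(I \<inter> K)"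
      using single x by blast
    moreover have "\<Inter>(I \<inter> K) \<noteq> {}"
      using x by blast
    ultimately show ?thesis
      using K by (simp add: connectivity_structure_def)
  qed
qed

section \<open>Generated structures\<close>

lemma generated0_least:
  assumes "connectivity_structure X K" "A \<subseteq> K"
  shows "generated0 X A \<subseteq> K"
proof -
  have "A \<subseteq> Pow X"
    using assms by (auto simp: connectivity_structure_def)
  then show ?thesis
    using assms by (auto simp: generated0_eq_Inter)
qed

lemma
  assumes "A \<subseteq> Pow X"
  shows connectivity_structure_generated0: "connectivity_structure X (generated0 X A)"
    and generated0_superset: "A \<subseteq> generated0 X A"
proof -
  have "Pow X \<in> {K. connectivity_structure X K \<and> A \<subseteq> K}"
    using assms by (simp add: connectivity_structure_Pow)
  then show "connectivity_structure X (generated0 X A)"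
    unfolding generated0_eq_Inter[OF assms] by (intro connectivity_structure_Inter) auto
  show "A \<subseteq> generated0 X A"
    unfolding generated0_eq_Inter[OF assms] by blast
qed

text \<open>Reduces the integral case to \<open>generated0\<close>, so that one convergence argument
  serves both claims.\<close>

lemma generated_eq_generated0: "generated X A = generated0 X (A \<union> singletons X)"
  by (simp add: generated_def generated0_def integral_connectivity_structure_def conj_ac)

section \<open>The ordinal \<open>omega0\<close>\<close>

lemma ord_succ_less_omega0:
  assumes "\<beta> < omega0"
  shows "ord_succ \<beta> < omega0"
proof -
  have fin: "finite {..<\<beta>}"
    using assms not_less_Least unfolding omega0_def by blast
  \<comment> \<open>At most one predecessor is gained, so finiteness persists, whereas
    \<open>omega0\<close> has infinitely many predecessors.\<close>
  have "{..<ord_succ \<beta>} \<subseteq> insert \<beta> {..<\<beta>}"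
    by (metis insertI1 insertI2 lessThan_iff linorder_neqE leD ord_succ_le_iff subsetI)
  then have "finite {..<ord_succ \<beta>}"
    using fin finite_subset by blast
  then have "ord_succ \<beta> \<noteq> omega0"
    using infinite_omega0 by metis
  then show ?thesis
    using assms ord_succ_le_iff by (metis order_le_less)
qed

lemma omega0_nonzero: "omega0 \<noteq> 0"
proof
  assume "omega0 = (0 :: 'b ordinal)"
  then have "{..<omega0 :: 'b ordinal} = {}"
    by (auto simp flip: not_le simp: zero_le_ordinal)
  then show False
    using infinite_omega0 by (metis finite.emptyI)
qed

section \<open>The transfinite process with added sets\<close>

lemma Phi_pow_adding_step:
  "Phi_pow_adding S \<gamma> (ord_succ \<beta>) U =
     Phi (Phi_pow_adding S \<gamma> \<beta> U) \<union> (if ord_succ \<beta> = \<gamma> then S else {})"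
  by (subst Phi_pow_adding.simps) (auto simp: the_ord_pred ord_succ_nonzero ord_succ_inject)

lemma Phi_pow_adding_limit:
  assumes "\<alpha> \<noteq> 0" "\<And>\<beta>. \<alpha> \<noteq> ord_succ \<beta>"
  shows "Phi_pow_adding S \<gamma> \<alpha> U =
     (\<Union>\<beta>\<in>{..<\<alpha>}. Phi_pow_adding S \<gamma> \<beta> U) \<union> (if \<alpha> = \<gamma> then S else {})"
  using assms by (subst Phi_pow_adding.simps) auto

lemma Phi_pow_adding_zero: "Phi_pow_adding S \<gamma> 0 U = U \<union> (if 0 = \<gamma> then S else {})"
  by (subst Phi_pow_adding.simps) auto

lemma ordinal_induct [case_names zero succ limit]:
  fixes \<alpha> :: "'b ordinal"
  assumes "P 0"
    and "\<And>\<beta>. P \<beta> \<Longrightarrow> P (ord_succ \<beta>)"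
    and "\<And>\<alpha>. \<alpha> \<noteq> 0 \<Longrightarrow> (\<And>\<beta>. \<alpha> \<noteq> ord_succ \<beta>) \<Longrightarrow> (\<And>\<beta>. \<beta> < \<alpha> \<Longrightarrow> P \<beta>) \<Longrightarrow> P \<alpha>"
  shows "P \<alpha>"
proof (induction \<alpha> rule: less_induct)
  case (less \<alpha>)
  show ?case
  proof (cases "\<exists>\<beta>. \<alpha> = ord_succ \<beta>")
    case True
    then show ?thesis
      using assms(2) less less_ord_succ by blast
  next
    case False
    then show ?thesis
      using assms(1) assms(3)[of \<alpha>] less by metis
  qed
qed

text \<open>Makes the plain process a special case, so that everything below is proved once, for
  \<open>Phi_pow_adding\<close>.\<close>

lemma Phi_pow_adding_empty: "Phi_pow_adding {} \<gamma> \<alpha> U = Phi_pow \<alpha> U"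
proof (induction \<alpha> rule: ordinal_induct)
  case zero
  show ?case by (simp add: Phi_pow_adding_zero Phi_pow_0)
next
  case (succ \<beta>)
  then show ?case by (simp add: Phi_pow_adding_step Phi_pow_succ)
next
  case (limit \<alpha>)
  then show ?case by (simp add: Phi_pow_adding_limit Phi_pow_limit)
qed

text \<open>\<open>Phi\<close> is inflationary, limit stages contain all earlier ones, and adding
  \<open>S\<close> only enlarges a stage.\<close>

lemma Phi_pow_adding_mono:
  "\<alpha> \<le> \<beta> \<Longrightarrow> Phi_pow_adding S \<gamma> \<alpha> U \<subseteq> Phi_pow_adding S \<gamma> \<beta> U"
proof (induction \<beta> rule: ordinal_induct)
  case zero
  then show ?case using zero_le_ordinal[of \<alpha>] by (metis order_antisym order_refl)
next
  case (succ \<beta>)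
  show ?case
  proof (cases "\<alpha> = ord_succ \<beta>")
    case False
    then have "\<alpha> \<le> \<beta>"
      using succ.prems ord_succ_le_iff[of \<beta> \<alpha>] by (metis leI order_antisym)
    then show ?thesis
      using succ.IH Phi_superset by (fastforce simp: Phi_pow_adding_step)
  qed simp
next
  case (limit \<beta>)
  show ?case
  proof (cases "\<alpha> = \<beta>")
    case False
    then have "\<alpha> \<in> {..<\<beta>}"
      using limit.prems by simp
    then show ?thesis
      unfolding Phi_pow_adding_limit[OF limit.hyps] by blast
  qed simp
qed

text \<open>Used with \<open>K\<close> the generated structure, as the upper bound on every stage,
  and with \<open>K = Pow X\<close>, to keep the stages within \<open>Pow X\<close>.\<close>

lemma Phi_pow_adding_subset_connectivity_structure:
  assumes K: "connectivity_structure X K" and "U \<subseteq> K" "S \<subseteq> K"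
  shows "Phi_pow_adding S \<gamma> \<alpha> U \<subseteq> K"
proof (induction \<alpha> rule: ordinal_induct)
  case zero
  show ?case using assms by (simp add: Phi_pow_adding_zero)
next
  case (succ \<beta>)
  then show ?case
    using Phi_subset_connectivity_structure[OF K succ] assms by (simp add: Phi_pow_adding_step)
next
  case (limit \<alpha>)
  then show ?case
    using \<open>S \<subseteq> K\<close> unfolding Phi_pow_adding_limit[OF limit.hyps]
    by (intro Un_least UN_least) auto
qed

section \<open>Stabilisation of the process\<close>

lemma Phi_pow_adding_omega0_binary_union:
  assumes S: "S \<subseteq> singletons X"
    and C: "C \<in> Phi_pow_adding S \<gamma> omega0 U" and D: "D \<in> Phi_pow_adding S \<gamma> omega0 U"
    and "C \<inter> D \<noteq> {}"
  shows "C \<union> D \<in> Phi_pow_adding S \<gamma> omega0 U"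
\<comment> \<open>When \<open>\<gamma> = omega0\<close>, members of \<open>S\<close> may be missing
  from all earlier stages, so they are treated first, by absorption.\<close>
proof (cases "C \<in> S \<or> D \<in> S")
  case True
  then have "C \<union> D = C \<or> C \<union> D = D"
    using S \<open>C \<inter> D \<noteq> {}\<close> by (auto simp: singletons_def)
  then show ?thesis
    using C D by metis
next
  case False
  have "omega0 \<noteq> ord_succ \<beta>" for \<beta> :: "'b ordinal"
    using ord_succ_less_omega0[of \<beta>] less_ord_succ[of \<beta>] by fastforce
  then have lim: "Phi_pow_adding S \<gamma> omega0 U =
      (\<Union>\<beta>\<in>{..<omega0}. Phi_pow_adding S \<gamma> \<beta> U) \<union> (if omega0 = \<gamma> then S else {})"
    by (intro Phi_pow_adding_limit omega0_nonzero)
  obtain \<beta> \<delta> where \<beta>: "\<beta> < omega0" "C \<in> Phi_pow_adding S \<gamma> \<beta> U"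
    and \<delta>: "\<delta> < omega0" "D \<in> Phi_pow_adding S \<gamma> \<delta> U"
    using C D False unfolding lim by (auto split: if_splits)
  have "C \<in> Phi_pow_adding S \<gamma> (max \<beta> \<delta>) U" "D \<in> Phi_pow_adding S \<gamma> (max \<beta> \<delta>) U"
    using \<beta> \<delta> Phi_pow_adding_mono[of _ "max \<beta> \<delta>"] by (meson max.cobounded1 max.cobounded2 subsetD)+
  then have "C \<union> D \<in> Phi_pow_adding S \<gamma> (ord_succ (max \<beta> \<delta>)) U"
    using \<open>C \<inter> D \<noteq> {}\<close> by (simp add: Phi_pow_adding_step Phi_binary_union)
  moreover have "ord_succ (max \<beta> \<delta>) < omega0"
    using \<beta> \<delta> by (intro ord_succ_less_omega0) simp
  ultimately show ?thesis
    using Phi_pow_adding_mono by (meson less_imp_le subsetD)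
qed

lemma connectivity_structure_Phi_pow_adding_succ_omega0:
  assumes U: "U \<subseteq> Pow X" and S: "S \<subseteq> singletons X"
  shows "connectivity_structure X (Phi_pow_adding S \<gamma> (ord_succ omega0) U)"
proof -
  have "S \<subseteq> Pow X"
    using S by (auto simp: singletons_def)
  then have "connectivity_structure X (Phi (Phi_pow_adding S \<gamma> omega0 U))"
    by (intro connectivity_structure_Phi Phi_pow_adding_omega0_binary_union[OF S]
        Phi_pow_adding_subset_connectivity_structure[OF connectivity_structure_Pow U])
  then show ?thesis
    \<comment> \<open>If \<open>\<gamma> = ord_succ omega0\<close>, then \<open>S\<close> joins
      after this last \<open>Phi\<close>, without destroying the structure.\<close>
    unfolding Phi_pow_adding_step using S by (intro connectivity_structure_Un_singletons) auto
qed

text \<open>Stage \<open>\<beta>\<close> is a structure containing \<open>A\<close> and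
  \<open>S\<close>, hence contains the generated one; later stages only grow, yet never leave the
  generated structure.\<close>

lemma Phi_pow_adding_eq_generated0I:
  assumes "connectivity_structure X (Phi_pow_adding S \<gamma> \<beta> A)"
    and "A \<subseteq> Pow X" "S \<subseteq> Pow X" "\<gamma> \<le> \<beta>" "\<beta> \<le> \<alpha>"
  shows "Phi_pow_adding S \<gamma> \<alpha> A = generated0 X (A \<union> S)"
proof
  have AS: "A \<union> S \<subseteq> Pow X"
    using assms by simp
  show "Phi_pow_adding S \<gamma> \<alpha> A \<subseteq> generated0 X (A \<union> S)"
    using connectivity_structure_generated0[OF AS] generated0_superset[OF AS]
    by (intro Phi_pow_adding_subset_connectivity_structure) auto
  have "A \<subseteq> Phi_pow_adding S \<gamma> 0 A" "S \<subseteq> Phi_pow_adding S \<gamma> \<gamma> A"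
    by (auto simp: Phi_pow_adding_zero Phi_pow_adding_same)
  then have "A \<union> S \<subseteq> Phi_pow_adding S \<gamma> \<beta> A"
    using Phi_pow_adding_mono zero_le_ordinal \<open>\<gamma> \<le> \<beta>\<close> by (metis Un_least order_trans)
  then have "generated0 X (A \<union> S) \<subseteq> Phi_pow_adding S \<gamma> \<beta> A"
    using assms(1) by (intro generated0_least)
  also have "\<dots> \<subseteq> Phi_pow_adding S \<gamma> \<alpha> A"
    using \<open>\<beta> \<le> \<alpha>\<close> by (rule Phi_pow_adding_mono)
  finally show "generated0 X (A \<union> S) \<subseteq> Phi_pow_adding S \<gamma> \<alpha> A" .
qed

lemma Phi_pow_eq_generated0:
  assumes "A \<subseteq> Pow X" "ord_succ omega0 \<le> \<alpha>"
  shows "Phi_pow \<alpha> A = generated0 X A"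
  \<comment> \<open>Adding the empty set of sets at stage \<open>0\<close> gives back the plain
    process.\<close>
  using Phi_pow_adding_eq_generated0I[of X "{}" 0 "ord_succ omega0" A \<alpha>]
    connectivity_structure_Phi_pow_adding_succ_omega0[of A X "{}" 0] assms
  by (simp add: Phi_pow_adding_empty zero_le_ordinal)

lemma Phi_pow_adding_singletons_eq_generated:
  assumes A: "A \<subseteq> Pow X" and "ord_succ omega0 \<le> \<alpha>" "\<gamma> \<le> \<alpha>"
  shows "Phi_pow_adding (singletons X) \<gamma> \<alpha> A = generated X A"
proof -
  let ?P = "\<lambda>\<alpha>. Phi_pow_adding (singletons X) \<gamma> \<alpha> A"
  \<comment> \<open>The maximum ensures both that the singletons are present and that stage
    \<open>ord_succ omega0\<close> has been reached.\<close>
  have "connectivity_structure X (?P (max \<gamma> (ord_succ omega0)))"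
  proof (cases "\<gamma> \<le> ord_succ omega0")
    case True
    then show ?thesis
      using connectivity_structure_Phi_pow_adding_succ_omega0[OF A order_refl]
      by (simp add: max_def)
  next
    case False
    \<comment> \<open>Before the late stage \<open>\<gamma>\<close> the plain process has already
      stabilised; adding singletons then yields a structure at once.\<close>
    then have "?P \<gamma> = generated0 X A \<union> singletons X"
      using A by (simp add: Phi_pow_adding_same Phi_pow_eq_generated0)
    then show ?thesis
      using False connectivity_structure_generated0[OF A]
      by (simp add: max_def connectivity_structure_Un_singletons)
  qed
  moreover have "singletons X \<subseteq> Pow X"
    by (auto simp: singletons_def)
  ultimately show ?thesis
    unfolding generated_eq_generated0 using assms
    by (intro Phi_pow_adding_eq_generated0I[where \<beta> = "max \<gamma> (ord_succ omega0)"]) auto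
qed

theorem theorem3:
  fixes X :: "'a set" and A :: "'a set set"
  assumes "A \<subseteq> Pow X"
  shows "(\<exists>\<alpha>\<^sub>0 \<le> ord_succ omega0. \<forall>\<alpha> :: 'b ordinal. \<alpha>\<^sub>0 \<le> \<alpha> \<longrightarrow>
            generated0 X A = Phi_pow \<alpha> A) \<and>
         (\<forall>\<gamma> :: 'b ordinal. \<exists>\<alpha>\<^sub>0 \<le> ord_succ omega0. \<forall>\<alpha>. \<alpha>\<^sub>0 \<le> \<alpha> \<and> \<gamma> \<le> \<alpha> \<longrightarrow>
            generated X A = Phi_pow_adding (singletons X) \<gamma> \<alpha> A)"
  \<comment> \<open>The same bound serves both claims and every \<open>\<gamma>\<close>.\<close>
  by (intro conjI allI exI[of _ "ord_succ omega0"])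
    (simp_all add: Phi_pow_eq_generated0[OF assms] Phi_pow_adding_singletons_eq_generated[OF assms])

end
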